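(* Let $A\in\mathbb{R}^{m\times n}$, $U\in\mathbb{R}^{m\times r}$ and $V\in\mathbb{R}^{n\times r}$ with $m\geq n\geq r$. Assume that $\operatorname{rank}(A)=\operatorname{rank}(A+UV^T)=n$. Then $$(A+UV^T)^\dagger = A^\dagger - MA^\dagger + (I-M)(A^TA)^{-1}VU^T,$$ where $$M = (A^TA)^{-1}X\bigl(I+Y^T(A^TA)^{-1}X\bigr)^{-1}Y^T,$$ $$X=[V,\ A^TU],\qquad Y=[(A+UV^T)^TU,\ V].$$
   Context: $B^\dagger$ denotes the Moore--Penrose pseudoinverse of a real matrix $B$. $I$ denotes an identity matrix of the appropriate size: in $I-M$ it is $n\times n$, and in $I+Y^T(A^TA)^{-1}X$ it is $2r\times 2r$. The notation $[P,\ Q]$ denotes horizontal (column-block) concatenation, so $X,Y\in\mathbb{R}^{n\times 2r}$ and $M\in\mathbb{R}^{n\times n}$. *)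

theory Defs
  imports "HOL-Analysis.Analysis"
begin

definition hcat :: "'a ^ 'k ^ 'n \<Rightarrow> 'a ^ 'l ^ 'n \<Rightarrow> 'a ^ ('k + 'l) ^ 'n" where
  "hcat P Q = (\<chi> i j. case j of Inl k \<Rightarrow> P $ i $ k | Inr l \<Rightarrow> Q $ i $ l)"

definition is_pinv :: "real ^ 'n ^ 'm \<Rightarrow> real ^ 'm ^ 'n \<Rightarrow> bool" where
  "is_pinv B Z \<longleftrightarrow>
     B ** Z ** B = B \<and>
     Z ** B ** Z = Z \<and>
     transpose (B ** Z) = B ** Z \<and>
     transpose (Z ** B) = Z ** B"

definition pinv :: "real ^ 'n ^ 'm \<Rightarrow> real ^ 'm ^ 'n" where
  "pinv B = (THE Z. is_pinv B Z)"

lemma is_pinv_unique: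
  assumes "is_pinv B Y" and "is_pinv B Z"
  shows "Y = Z"
proof -
  note y = assms(1)[unfolded is_pinv_def]
  note z = assms(2)[unfolded is_pinv_def]
  have "transpose (B ** Z ** (B ** Y)) = B ** Y ** (B ** Z)"
    by (simp only: matrix_transpose_mul[of "B ** Z"] y z)
  then have "transpose (B ** Y) = B ** Z"
    by (simp only: matrix_mul_assoc y z)
  then have BY: "B ** Y = B ** Z" by (simp only: y)
  have "transpose (Y ** B ** (Z ** B)) = Z ** B ** (Y ** B)"
    by (simp only: matrix_transpose_mul[of "Y ** B"] y z)
  moreover have "Y ** B ** (Z ** B) = Y ** B" "Z ** B ** (Y ** B) = Z ** B"
    by (simp_all only: y z flip: matrix_mul_assoc)
      (simp_all only: y z matrix_mul_assoc[of B])
  ultimately have YB: "Y ** B = Z ** B" by (simp only: y)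
  have "Y = Y ** B ** Y" by (simp only: y)
  also have "\<dots> = Z ** (B ** Y)" by (simp only: YB matrix_mul_assoc)
  also have "\<dots> = Z" by (simp only: BY z matrix_mul_assoc)
  finally show ?thesis .
qed

lemma ex_inner_inverse:
  fixes B :: "real ^ 'n ^ 'm"
  shows "\<exists>G. B ** G ** B = B"
proof -
  have lB: "linear ((*v) B)" by (rule matrix_vector_mul_linear)
  obtain g where g: "linear g" "\<And>y. y \<in> range ((*v) B) \<Longrightarrow> B *v g y = y"
    using linear_exists_right_inverse_on[OF lB subspace_UNIV] by auto
  have "B ** matrix g ** B = B"
    by (subst matrix_eq)
      (simp add: g matrix_works flip: matrix_vector_mul_assoc)
  then show ?thesis ..
qed

lemma transpose_mul_self_eq_0:
  fixes D :: "real ^ 'n ^ 'm"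
  assumes "transpose D ** D = 0"
  shows "D = 0"
proof -
  have "D *v x = 0" for x
  proof -
    have "(D *v x) \<bullet> (D *v x) = (transpose D *v (D *v x)) \<bullet> x"
      by (metis dot_lmul_matrix vector_transpose_matrix transpose_transpose)
    also have "\<dots> = 0"
      by (simp add: matrix_vector_mul_assoc assms)
    finally show ?thesis by simp
  qed
  then show ?thesis by (simp add: matrix_eq)
qed

lemma diff_ldistrib: "A ** (B - C) = A ** B - A ** C"
  for A :: "real ^ 'n ^ 'm"
  by (simp add: matrix_matrix_mult_def vec_eq_iff right_diff_distrib sum_subtractf)

lemma ex_inner_inverse_symmetric:
  fixes B :: "real ^ 'n ^ 'm"
  shows "\<exists>Z. B ** Z ** B = B \<and> transpose (B ** Z) = B ** Z"
proof -
  define C where "C = transpose B ** B"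
  have C: "transpose C = C" by (simp add: C_def matrix_transpose_mul)
  obtain G where G: "C ** G ** C = C" using ex_inner_inverse by blast
  have key: "B ** H ** C = B" if H: "C ** H ** C = C" for H
  proof -
    define K where "K = H ** C - mat 1"
    have CK: "C ** K = 0"
      using H by (simp add: K_def matrix_mul_assoc diff_ldistrib)
    have "transpose (B ** K) ** (B ** K) = transpose K ** (C ** K)"
      by (simp add: C_def matrix_transpose_mul matrix_mul_assoc)
    then have "transpose (B ** K) ** (B ** K) = 0" by (simp add: CK)
    then have "B ** K = 0" by (rule transpose_mul_self_eq_0)
    then show ?thesis
      by (simp add: K_def matrix_mul_assoc diff_ldistrib)
  qed
  have "C ** transpose G ** C = C"
    using arg_cong[OF G, of transpose] by (simp add: C matrix_transpose_mul matrix_mul_assoc)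
  note G1 = key[OF G] and G2 = key[OF this]
  define P where "P = B ** G ** transpose B"
  have "transpose P ** P = B ** transpose G ** C ** G ** transpose B"
    by (simp add: P_def C_def matrix_transpose_mul matrix_mul_assoc)
  also have "\<dots> = P" by (simp add: G2 P_def)
  finally have "transpose P = P"
    by (metis matrix_transpose_mul[of "transpose P" P] transpose_transpose)
  moreover have "P ** B = B"
    using G1 by (simp add: P_def C_def matrix_mul_assoc)
  ultimately show ?thesis
    by (intro exI[of _ "G ** transpose B"]) (simp add: P_def matrix_mul_assoc)
qed

lemma ex_is_pinv: "\<exists>Z. is_pinv B Z"
proof -
  obtain Y where Y: "B ** Y ** B = B" "transpose (B ** Y) = B ** Y"
    using ex_inner_inverse_symmetric by blast
  obtain W where W: "transpose B ** W ** transpose B = transpose B"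
      "transpose (transpose B ** W) = transpose B ** W"
    using ex_inner_inverse_symmetric by blast
  define Z where "Z = transpose W"
  have Z: "B ** Z ** B = B" "transpose (Z ** B) = Z ** B"
    using arg_cong[OF W(1), of transpose] W(2)
    by (simp_all add: Z_def matrix_transpose_mul matrix_mul_assoc)
  have 1: "B ** (Z ** B ** Y) = B ** Y" using Z(1) by (simp add: matrix_mul_assoc)
  have 2: "(Z ** B ** Y) ** B = Z ** B" 
    using Y(1) by (simp flip: matrix_mul_assoc)
  have "is_pinv B (Z ** B ** Y)"
    unfolding is_pinv_def 1 2
  proof (intro conjI)
    show "B ** Y ** B = B" by (fact Y(1))
    show "Z ** B ** (Z ** B ** Y) = Z ** B ** Y" 
      by (simp only: matrix_mul_assoc[of Z B "Z ** B ** Y", symmetric] 1)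
        (simp only: matrix_mul_assoc)
    show "transpose (B ** Y) = B ** Y" by (fact Y(2))
    show "transpose (Z ** B) = Z ** B" by (fact Z(2))
  qed
  then show ?thesis ..
qed

text \<open>Hence the definite description defining \<^const>\<open>pinv\<close> always denotes.\<close>

lemma is_pinv_pinv: "is_pinv B (pinv B)"
  unfolding pinv_def by (metis (mono_tags) ex_is_pinv is_pinv_unique theI)

lemma pinv_eqI: "is_pinv B Z \<Longrightarrow> pinv B = Z"
  using is_pinv_pinv is_pinv_unique by blast

end

theory Submission
  imports Defs
begin

text \<open>
  Write \<open>B = A + U V\<^sup>T\<close>, \<open>G = A\<^sup>T A\<close> and \<open>H = B\<^sup>T B\<close>. For a matrix of full column rank the Gram
  matrix is invertible and the pseudoinverse is the least-squares formula \<open>G\<^sup>-\<^sup>1 A\<^sup>T\<close>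
  (lemmas \<open>invertible_gram\<close> and \<open>pinv_full_column_rank\<close>), so the whole question is how \<open>G\<^sup>-\<^sup>1\<close>
  changes into \<open>H\<^sup>-\<^sup>1\<close>.

  The change of \<open>A\<close> by a matrix of rank at most \<open>r\<close> becomes a change of rank at most \<open>2 r\<close> of the Gram matrix:
  expanding \<open>B\<^sup>T B = (A\<^sup>T + V U\<^sup>T) B\<close> gives
  \<open>H = G + V (U\<^sup>T B) + (A\<^sup>T U) V\<^sup>T = G + X Y\<^sup>T\<close>. As \<open>G\<close> and \<open>H\<close> are both invertible, the
  capacitance matrix \<open>I + Y\<^sup>T G\<^sup>-\<^sup>1 X\<close> is invertible, with the explicit inverse \<open>I - Y\<^sup>T H\<^sup>-\<^sup>1 X\<close>.
  Substituting this inverse collapses \<open>M\<close> to \<open>I - H\<^sup>-\<^sup>1 G\<close>, which is the Sherman--Morrison--Woodbury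
  identity \<open>(I - M) G\<^sup>-\<^sup>1 = H\<^sup>-\<^sup>1\<close> (lemma \<open>woodbury\<close>). Multiplying on the right by
  \<open>B\<^sup>T = A\<^sup>T + V U\<^sup>T\<close> yields the formula.
\<close>

text \<open>
  This turns a sum of two outer products into a single product \<open>X Y\<^sup>T\<close>, the form of
  perturbation that \<open>woodbury\<close> treats.
\<close>

lemma hcat_mult_transpose_hcat:
  fixes P :: "'a::comm_semiring_1 ^ 'k ^ 'n" and R :: "'a ^ 'k ^ 'm"
  shows "hcat P Q ** transpose (hcat R S) = P ** transpose R + Q ** transpose S"
  by (simp add: hcat_def matrix_matrix_mult_def transpose_def vec_eq_iff
      flip: UNIV_Plus_UNIV add: sum.Plus)

lemma matrix_add_rdistrib: "(A + B) ** C = A ** C + B ** C"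
  for C :: "'a::semiring_1 ^ 'n ^ 'm"
  by (simp add: matrix_matrix_mult_def vec_eq_iff distrib_right sum.distrib)

lemma matrix_diff_rdistrib: "(A - B) ** C = A ** C - B ** C"
  for C :: "'a::ring_1 ^ 'n ^ 'm"
  by (simp add: matrix_matrix_mult_def vec_eq_iff left_diff_distrib sum_subtractf)

lemma matrix_inv_left_right:
  fixes A :: "'a::semiring_1 ^ 'n ^ 'm"
  assumes "invertible A"
  shows "matrix_inv A ** A = mat 1" and "A ** matrix_inv A = mat 1"
  using someI_ex[OF assms[unfolded invertible_def]] by (simp_all add: matrix_inv_def)

text \<open>
  Everything rests on the resolvent identity \<open>G\<^sup>-\<^sup>1 (H - G) H\<^sup>-\<^sup>1 = G\<^sup>-\<^sup>1 - H\<^sup>-\<^sup>1\<close> with \<open>H - G = X Z\<close>.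
  It shows that \<open>I - Z H\<^sup>-\<^sup>1 X\<close> is a right inverse of the square matrix \<open>S\<close>, hence its inverse;
  once \<open>S\<^sup>-\<^sup>1\<close> is known, the correction term can be computed and equals \<open>I - H\<^sup>-\<^sup>1 G\<close>.
\<close>

lemma woodbury:
  fixes G H :: "real ^ 'n ^ 'n" and X :: "real ^ 'k ^ 'n" and Z :: "real ^ 'n ^ 'k"
  defines "S \<equiv> mat 1 + Z ** matrix_inv G ** X"
  assumes G: "invertible G" and H: "invertible H" and HG: "H = G + X ** Z"
  shows "invertible S"
    and "(mat 1 - matrix_inv G ** X ** matrix_inv S ** Z) ** matrix_inv G = matrix_inv H"
proof -
  let ?G = "matrix_inv G" and ?H = "matrix_inv H"
  note inv = matrix_inv_left_right[OF G] matrix_inv_left_right[OF H]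
  note distr = diff_ldistrib matrix_diff_rdistrib matrix_add_ldistrib matrix_add_rdistrib
  define T where "T = mat 1 - Z ** ?H ** X"
  have XZ: "X ** Z = H - G" using HG by simp
  have resolvent: "?G ** X ** Z ** ?H = ?G - ?H"
  proof -
    have "?G ** X ** Z ** ?H = ?G ** (X ** Z) ** ?H" by (simp only: matrix_mul_assoc)
    also have "\<dots> = ?G ** (H ** ?H) - (?G ** G) ** ?H"
      by (simp only: XZ distr matrix_mul_assoc)
    finally show ?thesis by (simp only: inv matrix_mul_lid matrix_mul_rid)
  qed
  have "S ** T = mat 1 + Z ** (?G - ?H - ?G ** X ** Z ** ?H) ** X"
    by (simp add: S_def T_def distr matrix_mul_assoc)
  then have ST: "S ** T = mat 1"
    by (simp add: resolvent)
  then have TS: "T ** S = mat 1" by (simp add: matrix_left_right_inverse)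
  show S: "invertible S" using ST TS by (auto simp: invertible_def)
  have "matrix_inv S = T"
    by (metis TS S matrix_inv_left_right(2) matrix_mul_assoc matrix_mul_lid matrix_mul_rid)
  then have "?G ** X ** matrix_inv S ** Z = ?G ** (X ** Z) - ?G ** X ** Z ** ?H ** (X ** Z)"
    by (simp add: T_def distr matrix_mul_assoc)
  also have "\<dots> = ?H ** (H - G)"
    unfolding resolvent XZ by (simp add: distr)
  also have "\<dots> = mat 1 - ?H ** G" by (simp add: distr inv)
  finally have "mat 1 - ?G ** X ** matrix_inv S ** Z = ?H ** G" by simp
  then show "(mat 1 - ?G ** X ** matrix_inv S ** Z) ** ?G = ?H"
    by (simp add: inv flip: matrix_mul_assoc)
qed

text \<open>
  A kernel vector \<open>x\<close> of \<open>A\<^sup>T A\<close> satisfies \<open>\<parallel>A x\<parallel>\<^sup>2 = x\<^sup>T A\<^sup>T A x = 0\<close>, and full column rank makes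
  \<open>A\<close> injective.
\<close>

lemma invertible_gram:
  fixes A :: "real ^ 'n ^ 'm"
  assumes "rank A = CARD('n)"
  shows "invertible (transpose A ** A)"
proof -
  have inj: "inj ((*v) A)" using assms by (simp add: full_rank_injective)
  have "x = 0" if "(transpose A ** A) *v x = 0" for x
  proof -
    have "(A *v x) \<bullet> (A *v x) = (transpose A *v (A *v x)) \<bullet> x"
      by (metis dot_lmul_matrix vector_transpose_matrix transpose_transpose)
    also have "\<dots> = 0" using that by (simp add: matrix_vector_mul_assoc)
    finally have "A *v x = A *v 0" by simp
    then show ?thesis using inj by (simp only: inj_eq)
  qed
  then show ?thesis
    by (simp add: invertible_left_inverse matrix_left_invertible_ker)
qed

text \<open>
  The matrix \<open>G\<^sup>-\<^sup>1 A\<^sup>T\<close> is a left inverse of \<open>A\<close>, which settles three of the four Penrose conditions;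
  the remaining one, symmetry of the projection \<open>A G\<^sup>-\<^sup>1 A\<^sup>T\<close>, holds because \<open>G\<^sup>-\<^sup>1\<close> is symmetric.
\<close>

lemma pinv_full_column_rank:
  fixes A :: "real ^ 'n ^ 'm"
  assumes "rank A = CARD('n)"
  shows "pinv A = matrix_inv (transpose A ** A) ** transpose A"
proof -
  define G where "G = transpose A ** A"
  note inv = matrix_inv_left_right[OF invertible_gram[OF assms], folded G_def]
  have "transpose (matrix_inv G) ** G = mat 1"
    using arg_cong[OF inv(2), of transpose]
    by (simp add: G_def matrix_transpose_mul matrix_mul_assoc)
  then have sym: "transpose (matrix_inv G) = matrix_inv G"
    by (metis inv(2) matrix_mul_assoc matrix_mul_lid matrix_mul_rid)
  have ZA: "matrix_inv G ** transpose A ** A = mat 1"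
    using inv(1) by (simp add: G_def matrix_mul_assoc)
  have "is_pinv A (matrix_inv G ** transpose A)"
    unfolding is_pinv_def
  proof (intro conjI)
    show "A ** (matrix_inv G ** transpose A) ** A = A"
      by (simp add: ZA flip: matrix_mul_assoc[of A])
  qed (simp_all add: ZA sym matrix_transpose_mul matrix_mul_assoc)
  then show ?thesis
    unfolding G_def by (rule pinv_eqI)
qed

theorem theorem2p1:
  fixes A :: "real ^ 'n ^ 'm" and U :: "real ^ 'r ^ 'm" and V :: "real ^ 'r ^ 'n"
    and X Y :: "real ^ ('r + 'r) ^ 'n" and M :: "real ^ 'n ^ 'n"
  assumes "CARD('m) \<ge> CARD('n)" and "CARD('n) \<ge> CARD('r)"
    and "rank A = CARD('n)" and "rank (A + U ** transpose V) = CARD('n)"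
    and "X = hcat V (transpose A ** U)"
    and "Y = hcat (transpose (A + U ** transpose V) ** U) V"
    and "M = matrix_inv (transpose A ** A) ** X
               ** matrix_inv (mat 1 + transpose Y ** matrix_inv (transpose A ** A) ** X)
               ** transpose Y"
  shows "invertible (transpose A ** A)
    \<and> invertible (mat 1 + transpose Y ** matrix_inv (transpose A ** A) ** X)
    \<and> pinv (A + U ** transpose V)
        = pinv A - M ** pinv A
          + (mat 1 - M) ** matrix_inv (transpose A ** A) ** V ** transpose U"
proof -
  define B where "B = A + U ** transpose V"
  let ?G = "transpose A ** A" and ?H = "transpose B ** B"
  have G: "invertible ?G" and H: "invertible ?H"
    using assms(3,4) by (simp_all add: B_def invertible_gram)
  have Bt: "transpose B = transpose A + V ** transpose U"
    by (simp add: B_def matrix_transpose_mul[symmetric] transpose_def vec_eq_iff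
        matrix_matrix_mult_def mult.commute)
  have "X ** transpose Y = V ** (transpose U ** B) + transpose A ** U ** transpose V"
    unfolding assms(5,6) B_def[symmetric]
    by (simp add: hcat_mult_transpose_hcat matrix_transpose_mul)
  moreover have "?H = transpose A ** B + V ** transpose U ** B"
    by (simp only: Bt matrix_add_rdistrib)
  moreover have "transpose A ** B = ?G + transpose A ** U ** transpose V"
    by (simp add: B_def matrix_add_ldistrib matrix_mul_assoc)
  ultimately have HG: "?H = ?G + X ** transpose Y"
    by (simp add: matrix_mul_assoc)
  note wood = woodbury[OF G H HG, folded assms(7)]
  have "pinv B = matrix_inv ?H ** transpose B"
    using assms(4) by (simp add: B_def pinv_full_column_rank)
  also have "\<dots> = (mat 1 - M) ** matrix_inv ?G ** (transpose A + V ** transpose U)"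
    by (simp only: wood(2) Bt)
  also have "\<dots> = (mat 1 - M) ** pinv A + (mat 1 - M) ** matrix_inv ?G ** V ** transpose U"
    by (simp add: pinv_full_column_rank[OF assms(3)] matrix_add_ldistrib matrix_mul_assoc)
  also have "(mat 1 - M) ** pinv A = pinv A - M ** pinv A"
    by (simp add: matrix_diff_rdistrib)
  finally show ?thesis
    using G wood(1) by (simp add: B_def)
qed

end
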